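(* Let $a_{jk}(t)$ ($j,k=1,2$) be real-valued continuous functions on $[t_0,+\infty)$, and let $B(t)=a_{11}(t)-a_{22}(t)$. Consider the system $$\phi'=a_{11}(t)\phi+a_{12}(t)\psi,\qquad \psi'=a_{21}(t)\phi+a_{22}(t)\psi,\qquad t\ge t_0.$$ Suppose that: 1) $a_{12}(t)\ge 0$ for all $t\ge t_0$; 2) $$\int_{t_0}^{+\infty}a_{12}(\tau)\exp\Big\{-\int_{t_0}^{\tau}B(s)\,ds\Big\}d\tau=-\int_{t_0}^{+\infty}a_{21}(\tau)\exp\Big\{\int_{t_0}^{\tau}B(s)\,ds\Big\}d\tau=+\infty.$$ Then the system is oscillatory.
   Context: All solutions are real-valued. Integrals over $[t_0,+\infty)$ are improper integrals, i.e. limits of integrals over $[t_0,t]$ as $t\to+\infty$. A continuous function on $[t_0,+\infty)$ is called oscillatory if it has arbitrarily large zeros. The system is called oscillatory if for each of its nontrivial solutions $(\phi(t),\psi(t))$ both functions $\phi(t)$ and $\psi(t)$ are oscillatory. *)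

theory Defs
  imports "HOL-Analysis.Analysis"
begin

text \<open>
  Functions on \<open>[t0, \<infinity>)\<close> are total functions on the reals of which only the
  values on \<open>{t0..}\<close> matter. The derivative within \<open>{t0..}\<close> is the ordinary derivative for
  \<open>t > t0\<close> and the right derivative at \<open>t0\<close>.
\<close>

definition is_solution ::
  "real \<Rightarrow> (real \<Rightarrow> real) \<Rightarrow> (real \<Rightarrow> real) \<Rightarrow> (real \<Rightarrow> real) \<Rightarrow> (real \<Rightarrow> real) \<Rightarrow>
   (real \<Rightarrow> real) \<Rightarrow> (real \<Rightarrow> real) \<Rightarrow> bool" where
  "is_solution t0 a11 a12 a21 a22 \<phi> \<psi> \<longleftrightarrow>
     (\<forall>t\<ge>t0. (\<phi> has_real_derivative a11 t * \<phi> t + a12 t * \<psi> t) (at t within {t0..}) \<and>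
             (\<psi> has_real_derivative a21 t * \<phi> t + a22 t * \<psi> t) (at t within {t0..}))"

definition nontrivial :: "real \<Rightarrow> (real \<Rightarrow> real) \<Rightarrow> (real \<Rightarrow> real) \<Rightarrow> bool" where
  "nontrivial t0 \<phi> \<psi> \<longleftrightarrow> (\<exists>t\<ge>t0. \<phi> t \<noteq> 0 \<or> \<psi> t \<noteq> 0)"

definition oscillatory :: "real \<Rightarrow> (real \<Rightarrow> real) \<Rightarrow> bool" where
  "oscillatory t0 f \<longleftrightarrow> continuous_on {t0..} f \<and> (\<forall>T\<ge>t0. \<exists>t\<ge>T. f t = 0)"

definition oscillatory_system ::
  "real \<Rightarrow> (real \<Rightarrow> real) \<Rightarrow> (real \<Rightarrow> real) \<Rightarrow> (real \<Rightarrow> real) \<Rightarrow> (real \<Rightarrow> real) \<Rightarrow> bool" where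
  "oscillatory_system t0 a11 a12 a21 a22 \<longleftrightarrow>
     (\<forall>\<phi> \<psi>. is_solution t0 a11 a12 a21 a22 \<phi> \<psi> \<and> nontrivial t0 \<phi> \<psi> \<longrightarrow>
        oscillatory t0 \<phi> \<and> oscillatory t0 \<psi>)"

end

theory Submission
  imports Defs
begin

text \<open>
  Multiplying \<open>\<phi>\<close> and \<open>\<psi>\<close> by the integrating factors \<open>exp (- \<integral> a11)\<close> and \<open>exp (- \<integral> a22)\<close> changes
  no zeros and removes the diagonal of the system. The new pair satisfies \<open>u' = p v\<close> and
  \<open>v' = - q u\<close>, where \<open>p = a12 exp (- \<integral> B) \<ge> 0\<close> and \<open>q = - a21 exp (\<integral> B)\<close> are, up to sign, the two
  integrands of the hypothesis. So \<open>p\<close> and \<open>q\<close> have antiderivatives \<open>P\<close> and \<open>Q\<close> that tend to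
  infinity, while \<open>q\<close> may change sign.

  If \<open>u\<close> has no zeros from some point on, then \<open>w = v / u\<close> solves the Riccati equation
  \<open>w' = - q - p w\<^sup>2\<close>. Since \<open>Q\<close> tends to infinity, \<open>- w\<close> eventually dominates a positive function
  \<open>R\<close> with \<open>R' = p w\<^sup>2 \<ge> p R\<^sup>2\<close>. Then \<open>P + 1 / R\<close> is nonincreasing, so \<open>P\<close> is bounded, which is
  absurd (lemma \<open>reduced_system_fst_zeros\<close>).

  If \<open>v\<close> has no zeros from some point on, then \<open>u' = p v\<close> has a constant sign, so \<open>u\<close> is monotone.
  A monotone function with arbitrarily large zeros vanishes identically from its first zero on.
  But then \<open>v\<close> is a nonzero constant \<open>c\<close> there, and \<open>u' = c p\<close> makes \<open>P\<close> eventually constant, which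
  is again absurd (lemma \<open>reduced_system_snd_zeros\<close>).
\<close>

section \<open>Derivatives on a half-line\<close>

lemma half_line_nonneg_deriv_imp_mono:
  fixes f f' :: "real \<Rightarrow> real"
  assumes deriv: "\<And>t. t \<ge> T \<Longrightarrow> (f has_real_derivative f' t) (at t within {T..})"
    and nonneg: "\<And>t. t \<ge> T \<Longrightarrow> f' t \<ge> 0"
    and "T \<le> a" "a \<le> b"
  shows "f a \<le> f b"
proof (rule DERIV_nonneg_imp_increasing_open[OF \<open>a \<le> b\<close>])
  fix x assume x: "a < x" "x < b"
  have "at x within {T..} = at x"
    using x \<open>T \<le> a\<close> by (intro at_within_interior) auto
  then show "\<exists>y. DERIV f x :> y \<and> y \<ge> 0"
    using deriv[of x] nonneg[of x] x \<open>T \<le> a\<close> by auto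
next
  have "continuous_on {T..} f"
    using deriv by (auto intro: DERIV_continuous_on)
  then show "continuous_on {a..b} f"
    by (rule continuous_on_subset) (use \<open>T \<le> a\<close> in auto)
qed

lemma half_line_zero_deriv_imp_const:
  fixes f :: "real \<Rightarrow> real"
  assumes deriv: "\<And>t. t \<ge> T \<Longrightarrow> (f has_real_derivative 0) (at t within {T..})"
    and "T \<le> a"
  shows "f a = f T"
proof (rule antisym)
  show "f T \<le> f a"
    by (rule half_line_nonneg_deriv_imp_mono[OF deriv]) (use \<open>T \<le> a\<close> in auto)
  have "- f T \<le> - f a"
    by (rule half_line_nonneg_deriv_imp_mono[where f' = "\<lambda>_. 0" and T = T])
      (use \<open>T \<le> a\<close> in \<open>auto intro!: derivative_eq_intros deriv\<close>)
  then show "f a \<le> f T" by simp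
qed

lemma integral_has_real_derivative_half_line:
  fixes f :: "real \<Rightarrow> real"
  assumes "continuous_on {t0..} f" "t \<ge> t0"
  shows "((\<lambda>t. integral {t0..t} f) has_real_derivative f t) (at t within {t0..})"
proof -
  have "continuous_on {t0..t+1} f"
    by (rule continuous_on_subset[OF assms(1)]) auto
  then have "((\<lambda>t. integral {t0..t} f) has_real_derivative f t) (at t within {t0..t+1})"
    by (rule integral_has_real_derivative) (use \<open>t \<ge> t0\<close> in auto)
  moreover have "at t within {t0..t+1} = at t within {t0..}"
    by (rule at_within_nhd[of _ "{..<t+1}"]) auto
  ultimately show ?thesis by simp
qed

lemma integrating_factor_derivative:
  fixes f A :: "real \<Rightarrow> real"
  assumes "(f has_real_derivative a * f t + b) (at t within S)"
    and "(A has_real_derivative a) (at t within S)"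
  shows "((\<lambda>s. f s * exp (- A s)) has_real_derivative b * exp (- A t)) (at t within S)"
  by (rule derivative_eq_intros assms refl)+ (simp add: algebra_simps)

section \<open>Zeros of solutions of the reduced system\<close>

text \<open>
  The contradiction comes from blow-up of the Riccati equation. The integral of \<open>p w\<^sup>2\<close> is never
  formed: up to an additive constant it is \<open>- (w + Q)\<close>.
\<close>

lemma reduced_system_fst_zeros:
  fixes p q P Q u v :: "real \<Rightarrow> real"
  assumes P: "\<And>t. t \<ge> T \<Longrightarrow> (P has_real_derivative p t) (at t within {T..})"
    and Q: "\<And>t. t \<ge> T \<Longrightarrow> (Q has_real_derivative q t) (at t within {T..})"
    and u: "\<And>t. t \<ge> T \<Longrightarrow> (u has_real_derivative p t * v t) (at t within {T..})"
    and v: "\<And>t. t \<ge> T \<Longrightarrow> (v has_real_derivative - q t * u t) (at t within {T..})"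
    and p: "\<And>t. t \<ge> T \<Longrightarrow> p t \<ge> 0"
    and P_top: "filterlim P at_top at_top" and Q_top: "filterlim Q at_top at_top"
  shows "\<exists>t\<ge>T. u t = 0"
proof (rule ccontr)
  assume "\<not> ?thesis"
  then have nz: "u t \<noteq> 0" if "t \<ge> T" for t using that by auto
  define w where "w t = v t / u t" for t
  define S where "S t = - (w t + Q t)" for t
  have S: "(S has_real_derivative p t * (w t)\<^sup>2) (at t within {T..})" if "t \<ge> T" for t
    unfolding S_def w_def
    by (rule derivative_eq_intros u[OF that] v[OF that] Q[OF that] nz[OF that] refl)+
      (use nz[OF that] in \<open>simp add: field_simps power2_eq_square\<close>)
  have S_ge: "S t \<ge> S T" if "t \<ge> T" for t
    by (rule half_line_nonneg_deriv_imp_mono[OF S]) (use that p in auto)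
  \<comment> \<open>From \<open>T1\<close> on, \<open>Q\<close> makes up for the unknown constant \<open>S T\<close>, with a margin of 1 to keep \<open>R\<close>
    positive.\<close>
  obtain T0 where T0: "\<And>t. t \<ge> T0 \<Longrightarrow> Q t \<ge> 1 - S T"
    using Q_top unfolding filterlim_at_top eventually_at_top_linorder by blast
  define T1 where "T1 = max T T0"
  define R where "R t = S t - S T + 1" for t
  have R_ge: "R t \<ge> 1" if "t \<ge> T1" for t
    using S_ge[of t] that by (simp add: R_def T1_def)
  have R_le: "R t \<le> - w t" if "t \<ge> T1" for t
    using T0[of t] that by (simp add: R_def S_def T1_def)
  have deriv: "((\<lambda>s. - (P s + 1 / R s)) has_real_derivative p t * ((w t)\<^sup>2 / (R t)\<^sup>2 - 1))
      (at t within {T1..})" if "t \<ge> T1" for t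
  proof -
    have t: "t \<ge> T" and sub: "{T1..} \<subseteq> {T..}" using that by (auto simp: T1_def)
    have nz_R: "R t \<noteq> 0" using R_ge[OF that] by simp
    have R: "(R has_real_derivative p t * (w t)\<^sup>2) (at t within {T1..})"
      unfolding R_def
      by (rule derivative_eq_intros DERIV_subset[OF S[OF t] sub] refl)+ simp
    show ?thesis
      by (rule derivative_eq_intros R DERIV_subset[OF P[OF t] sub] nz_R refl)+
        (use nz_R in \<open>simp add: field_simps power2_eq_square\<close>)
  qed
  have nonneg: "p t * ((w t)\<^sup>2 / (R t)\<^sup>2 - 1) \<ge> 0" if "t \<ge> T1" for t
  proof -
    have "(R t)\<^sup>2 \<le> (- w t)\<^sup>2"
      using R_ge[OF that] R_le[OF that] by (intro power_mono) auto
    then have "1 \<le> (w t)\<^sup>2 / (R t)\<^sup>2"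
      using R_ge[OF that] by (simp add: field_simps)
    then show ?thesis using p[of t] that by (simp add: T1_def)
  qed
  have bound: "P t \<le> P T1 + 1 / R T1" if "t \<ge> T1" for t
  proof -
    have "- (P T1 + 1 / R T1) \<le> - (P t + 1 / R t)"
      by (rule half_line_nonneg_deriv_imp_mono[OF deriv nonneg]) (use that in auto)
    moreover have "1 / R t \<ge> 0" using R_ge[OF that] by simp
    ultimately show ?thesis by linarith
  qed
  obtain T2 where "\<And>t. t \<ge> T2 \<Longrightarrow> P t \<ge> P T1 + 1 / R T1 + 1"
    using P_top unfolding filterlim_at_top eventually_at_top_linorder by blast
  from this[of "max T1 T2"] bound[of "max T1 T2"] show False by simp
qed

text \<open>
  If \<open>v > 0\<close>, the zeros of \<open>u\<close> squeeze the nondecreasing function \<open>u\<close> to \<open>0\<close>. The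
  function \<open>p\<close> may well vanish on a bounded interval, so the contradiction is not with \<open>u' = p v\<close>
  at a single point, but with the divergence of \<open>P\<close>.
\<close>

lemma reduced_system_snd_not_pos:
  fixes p q P u v :: "real \<Rightarrow> real"
  assumes P: "\<And>t. t \<ge> T \<Longrightarrow> (P has_real_derivative p t) (at t within {T..})"
    and u: "\<And>t. t \<ge> T \<Longrightarrow> (u has_real_derivative p t * v t) (at t within {T..})"
    and v: "\<And>t. t \<ge> T \<Longrightarrow> (v has_real_derivative - q t * u t) (at t within {T..})"
    and p: "\<And>t. t \<ge> T \<Longrightarrow> p t \<ge> 0"
    and P_top: "filterlim P at_top at_top"
    and zeros: "\<And>t. t \<ge> T \<Longrightarrow> \<exists>s\<ge>t. u s = 0"
  shows "\<exists>t\<ge>T. v t \<le> 0"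
proof (rule ccontr)
  assume "\<not> ?thesis"
  then have pos: "v t > 0" if "t \<ge> T" for t using that by force
  have mono: "u a \<le> u b" if "T \<le> a" "a \<le> b" for a b
    by (rule half_line_nonneg_deriv_imp_mono[OF u _ that])
      (simp_all add: p pos[THEN less_imp_le])
  obtain t1 where t1: "t1 \<ge> T" "u t1 = 0" using zeros[of T] by auto
  have u0: "u t = 0" if t: "t \<ge> t1" for t
  proof -
    obtain s where "s \<ge> t" "u s = 0" using zeros[of t] t t1 by auto
    then show ?thesis using mono[of t1 t] mono[of t s] t t1 by auto
  qed
  have sub: "{t1..} \<subseteq> {T..}" using t1 by auto
  have v_const: "v t = v t1" if "t \<ge> t1" for t
  proof (rule half_line_zero_deriv_imp_const[OF _ that])
    fix s assume "s \<ge> t1"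
    then show "(v has_real_derivative 0) (at s within {t1..})"
      using DERIV_subset[OF v[of s] sub] u0[of s] t1 by simp
  qed
  have P_const: "P t = P t1" if "t \<ge> t1" for t
  proof -
    have "u t - v t1 * P t = u t1 - v t1 * P t1"
    proof (rule half_line_zero_deriv_imp_const[OF _ that])
      fix s assume s: "s \<ge> t1"
      then have "s \<ge> T" using t1 by simp
      show "((\<lambda>t. u t - v t1 * P t) has_real_derivative 0) (at s within {t1..})"
        by (rule derivative_eq_intros DERIV_subset[OF u[OF \<open>s \<ge> T\<close>] sub]
              DERIV_subset[OF P[OF \<open>s \<ge> T\<close>] sub] refl)+
          (use v_const[OF s] in simp)
    qed
    then show ?thesis using u0[of t] u0[of t1] that pos[of t1] t1 by simp
  qed
  obtain T2 where "\<And>t. t \<ge> T2 \<Longrightarrow> P t \<ge> P t1 + 1"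
    using P_top unfolding filterlim_at_top eventually_at_top_linorder by blast
  from this[of "max t1 T2"] P_const[of "max t1 T2"] show False by simp
qed

text \<open>
  The system is invariant under \<open>(u, v) \<mapsto> (- u, - v)\<close>, so \<open>v\<close> can be neither positive nor negative
  throughout \<open>[T, \<infinity>)\<close>; a zero then exists by the intermediate value theorem.
\<close>

lemma reduced_system_snd_zeros:
  fixes p q P u v :: "real \<Rightarrow> real"
  assumes P: "\<And>t. t \<ge> T \<Longrightarrow> (P has_real_derivative p t) (at t within {T..})"
    and u: "\<And>t. t \<ge> T \<Longrightarrow> (u has_real_derivative p t * v t) (at t within {T..})"
    and v: "\<And>t. t \<ge> T \<Longrightarrow> (v has_real_derivative - q t * u t) (at t within {T..})"
    and p: "\<And>t. t \<ge> T \<Longrightarrow> p t \<ge> 0"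
    and P_top: "filterlim P at_top at_top"
    and zeros: "\<And>t. t \<ge> T \<Longrightarrow> \<exists>s\<ge>t. u s = 0"
  shows "\<exists>t\<ge>T. v t = 0"
proof -
  obtain a where a: "a \<ge> T" "v a \<le> 0"
    using reduced_system_snd_not_pos[OF P u v p P_top zeros] by auto
  have "\<exists>t\<ge>T. - v t \<le> 0"
  proof (rule reduced_system_snd_not_pos[where u = "\<lambda>t. - u t" and q = q, OF P _ _ p P_top])
    show "((\<lambda>t. - u t) has_real_derivative p t * - v t) (at t within {T..})" if "t \<ge> T" for t
      using DERIV_minus[OF u[OF that]] by simp
    show "((\<lambda>t. - v t) has_real_derivative - q t * - u t) (at t within {T..})" if "t \<ge> T" for t
      using DERIV_minus[OF v[OF that]] by simp
  qed (use zeros in auto)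
  then obtain b where b: "b \<ge> T" "v b \<ge> 0" by auto
  have "continuous_on {T..} v"
    by (rule DERIV_continuous_on[OF v]) simp
  then have "connected (v ` {T..})"
    by (rule connected_continuous_image) (rule connected_Ici)
  then have "0 \<in> v ` {T..}"
    by (rule connectedD_interval[where x = "v a" and y = "v b"]) (use a b in auto)
  then show ?thesis by auto
qed

section \<open>Reduction of the full system\<close>

theorem theorem3p4:
  fixes t0 :: real and a11 a12 a21 a22 B :: "real \<Rightarrow> real"
  assumes "continuous_on {t0..} a11" and "continuous_on {t0..} a12"
    and "continuous_on {t0..} a21" and "continuous_on {t0..} a22"
    and "\<And>t. t \<ge> t0 \<Longrightarrow> B t = a11 t - a22 t"
    and "\<And>t. t \<ge> t0 \<Longrightarrow> a12 t \<ge> 0"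
    and "filterlim (\<lambda>t. integral {t0..t} (\<lambda>\<tau>. a12 \<tau> * exp (- integral {t0..\<tau>} B))) at_top at_top"
    and "filterlim (\<lambda>t. - integral {t0..t} (\<lambda>\<tau>. a21 \<tau> * exp (integral {t0..\<tau>} B))) at_top at_top"
  shows "oscillatory_system t0 a11 a12 a21 a22"
  unfolding oscillatory_system_def
proof (intro allI impI)
  fix \<phi> \<psi> assume "is_solution t0 a11 a12 a21 a22 \<phi> \<psi> \<and> nontrivial t0 \<phi> \<psi>"
  then have \<phi>: "(\<phi> has_real_derivative a11 t * \<phi> t + a12 t * \<psi> t) (at t within {t0..})"
    and \<psi>: "(\<psi> has_real_derivative a22 t * \<psi> t + a21 t * \<phi> t) (at t within {t0..})"
    if "t \<ge> t0" for t
    using that by (auto simp: is_solution_def add.commute)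
  define A1 where "A1 t = integral {t0..t} a11" for t
  define A2 where "A2 t = integral {t0..t} a22" for t
  define I where "I t = integral {t0..t} B" for t
  have A1: "(A1 has_real_derivative a11 t) (at t within {t0..})"
    and A2: "(A2 has_real_derivative a22 t) (at t within {t0..})" if "t \<ge> t0" for t
    unfolding A1_def A2_def
    using integral_has_real_derivative_half_line that assms(1,4) by auto
  have B_cont: "continuous_on {t0..} B"
    using continuous_on_diff[OF assms(1,4)] assms(5) by (subst continuous_on_cong[OF refl]) auto
  have I_cont: "continuous_on {t0..} I"
    unfolding I_def
    by (rule DERIV_continuous_on[where D = B], rule integral_has_real_derivative_half_line)
      (use B_cont in auto)
  have I_eq: "I t = A1 t - A2 t" if "t \<ge> t0" for t
  proof -
    have "I t = integral {t0..t} (\<lambda>s. a11 s - a22 s)"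
      unfolding I_def by (rule integral_cong) (use assms(5) in auto)
    also have "\<dots> = A1 t - A2 t"
      unfolding A1_def A2_def
      by (intro integral_diff integrable_continuous_real
          continuous_on_subset[OF assms(1)] continuous_on_subset[OF assms(4)]) auto
    finally show ?thesis .
  qed
  define p where "p t = a12 t * exp (- I t)" for t
  define q where "q t = - (a21 t * exp (I t))" for t
  define P where "P t = integral {t0..t} p" for t
  define Q where "Q t = integral {t0..t} q" for t
  have P: "(P has_real_derivative p t) (at t within {t0..})"
    and Q: "(Q has_real_derivative q t) (at t within {t0..})" if "t \<ge> t0" for t
  proof -
    have "continuous_on {t0..} p" "continuous_on {t0..} q"
      unfolding p_def q_def by (intro continuous_intros assms I_cont)+
    then show "(P has_real_derivative p t) (at t within {t0..})"
      "(Q has_real_derivative q t) (at t within {t0..})"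
      unfolding P_def Q_def using that by (auto intro: integral_has_real_derivative_half_line)
  qed
  have P_top: "filterlim P at_top at_top"
    using assms(7) by (simp add: P_def[abs_def] p_def[abs_def] I_def)
  have Q_top: "filterlim Q at_top at_top"
    using assms(8) by (simp add: Q_def[abs_def] q_def[abs_def] I_def)
  have p: "p t \<ge> 0" if "t \<ge> t0" for t
    using assms(6)[OF that] by (simp add: p_def)
  define u where "u t = \<phi> t * exp (- A1 t)" for t
  define v where "v t = \<psi> t * exp (- A2 t)" for t
  have u: "(u has_real_derivative p t * v t) (at t within {t0..})" if "t \<ge> t0" for t
  proof -
    have "exp (- A1 t) = exp (- I t) * exp (- A2 t)"
      using I_eq[OF that] by (simp flip: exp_add)
    then show ?thesis
      using integrating_factor_derivative[OF \<phi>[OF that] A1[OF that]]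
      by (simp add: u_def[abs_def] v_def p_def mult_ac)
  qed
  have v: "(v has_real_derivative - q t * u t) (at t within {t0..})" if "t \<ge> t0" for t
  proof -
    have "exp (- A2 t) = exp (I t) * exp (- A1 t)"
      using I_eq[OF that] by (simp flip: exp_add)
    then show ?thesis
      using integrating_factor_derivative[OF \<psi>[OF that] A2[OF that]]
      by (simp add: v_def[abs_def] u_def q_def mult_ac)
  qed
  have u_zeros: "\<exists>t\<ge>T. u t = 0" if "T \<ge> t0" for T
    by (rule reduced_system_fst_zeros[of T P p Q q u v])
      (use that in \<open>auto intro: DERIV_subset[OF P] DERIV_subset[OF Q] DERIV_subset[OF u]
          DERIV_subset[OF v, simplified] p P_top Q_top\<close>)
  have v_zeros: "\<exists>t\<ge>T. v t = 0" if "T \<ge> t0" for T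
    by (rule reduced_system_snd_zeros[of T P p u v q])
      (use that in \<open>auto intro: DERIV_subset[OF P] DERIV_subset[OF u]
          DERIV_subset[OF v, simplified] p P_top u_zeros\<close>)
  have "continuous_on {t0..} \<phi>" "continuous_on {t0..} \<psi>"
    by (auto intro!: DERIV_continuous_on \<phi> \<psi>)
  then show "oscillatory t0 \<phi> \<and> oscillatory t0 \<psi>"
    using u_zeros v_zeros by (auto simp: oscillatory_def u_def v_def)
qed

end
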